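(* Let $\mathbb{F}_q$ be a finite field with $q$ a power of an odd prime and $q\equiv 1\pmod 4$, and let $\chi_4$ be a character of $\mathbb{F}_q^*$ of order $4$. Let $z\in\mathbb{F}_q$ with $z\notin\{0,1,-1\}$. Then for every multiplicative character $D$ of $\mathbb{F}_q$, \[ D^4(z-1)\;{}_2F_1\left(\begin{array}{r|} D,\ D\chi_4 \\ \chi_4\end{array}\ z^4\right) ={}_2F_1\left(\begin{array}{r|} D,\ D^2\phi \\ D\phi\end{array}\ -\left(\frac{z+1}{z-1}\right)^2\right). \]
   Context: $q$ is a power of an odd prime $p$. All characters are complex multiplicative characters on $\mathbb{F}_q^*$, extended to $\mathbb{F}_q$ by setting their value at $0$ equal to $0$ (this applies also to the trivial character). $\varepsilon$ denotes the trivial character and $\phi$ the quadratic character. Products of characters are pointwise products, $\overline{A}$ is the complex conjugate (inverse) character, and $D^4(z-1)=(D(z-1))^4$. For characters $A,B,C$ and $x\in\mathbb{F}_q$, the hypergeometric function over $\mathbb{F}_q$ is \[ {}_2F_1\left(\begin{array}{r|} A,B \\ C\end{array}\ x\right)=\frac{\varepsilon(x)}{q}\sum_{y\in\mathbb{F}_q}B(y)\,(\overline{B}C)(y-1)\,\overline{A}(1-xy). \] *)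

theory Defs
  imports Complex_Main "HOL-Number_Theory.Number_Theory" "HOL-Library.Cardinality"
begin

text \<open>
  A multiplicative character of a field is given as a function on the whole field, with the
  convention that every character, including the trivial one, vanishes at \<open>0\<close>.
\<close>

definition mult_char :: "('a::field \<Rightarrow> complex) \<Rightarrow> bool" where
  "mult_char \<chi> \<longleftrightarrow>
     \<chi> 0 = 0 \<and> (\<forall>x. x \<noteq> 0 \<longrightarrow> \<chi> x \<noteq> 0) \<and> (\<forall>x y. \<chi> (x * y) = \<chi> x * \<chi> y)"

definition trivial_char :: "'a::field \<Rightarrow> complex" where
  "trivial_char x = (if x = 0 then 0 else 1)"

definition quadratic_char :: "'a::field \<Rightarrow> complex" where
  "quadratic_char x = (if x = 0 then 0 else if \<exists>y. x = y ^ 2 then 1 else - 1)"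

definition char_has_order :: "('a::field \<Rightarrow> complex) \<Rightarrow> nat \<Rightarrow> bool" where
  "char_has_order \<chi> n \<longleftrightarrow>
     0 < n \<and> (\<lambda>x. \<chi> x ^ n) = trivial_char \<and>
     (\<forall>m. 0 < m \<and> m < n \<longrightarrow> (\<lambda>x. \<chi> x ^ m) \<noteq> trivial_char)"

definition hyp2F1 ::
  "('a::{field,finite} \<Rightarrow> complex) \<Rightarrow> ('a \<Rightarrow> complex) \<Rightarrow> ('a \<Rightarrow> complex) \<Rightarrow> 'a \<Rightarrow> complex" where
  "hyp2F1 A B C x =
     trivial_char x / of_nat CARD('a) *
     (\<Sum>y\<in>UNIV. B y * (cnj (B (y - 1)) * C (y - 1)) * cnj (A (1 - x * y)))"

end

theory Submission
  imports Defs
begin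

text \<open>
  Write \<open>\<phi>\<close> for the quadratic character. After the substitutions \<open>y = u / z\<^sup>2\<close> on the left and
  \<open>1 / y = - z (2 + r) / (z - 1)\<^sup>2\<close> on the right, both sides become \<open>\<phi>(z)\<close> times a weighted sum of values of
  \<open>g(s) = cnj (D ((1 + z^4 - s z\<^sup>2) / (z - 1)^4))\<close>, and the theorem reduces to
  \<open>\<Sum>u. \<chi>\<^sub>4(u) g(u + 1/u) = \<Sum>r. \<phi>(2 + r) g(r\<^sup>2 - 2)\<close>, which holds for every function \<open>g\<close>.
  Pairing \<open>u\<close> with \<open>1/u\<close> kills the nonsquares \<open>u\<close>, so that twice the left-hand side is
  \<open>\<Sum>a. \<phi>(a) g(a\<^sup>2 + 1/a\<^sup>2)\<close>; now group by \<open>r = a + 1/a\<close> and use that \<open>\<phi>\<close> sums to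
  \<open>\<phi>(r + 2) + \<phi>(r - 2)\<close> over the solutions \<open>a\<close> of \<open>a + 1/a = r\<close>.
\<close>

section \<open>Multiplicative characters of a finite field\<close>

lemma mult_char_0: "mult_char \<chi> \<Longrightarrow> \<chi> 0 = 0"
  and mult_char_nonzero: "mult_char \<chi> \<Longrightarrow> x \<noteq> 0 \<Longrightarrow> \<chi> x \<noteq> 0"
  and mult_char_mult: "mult_char \<chi> \<Longrightarrow> \<chi> (x * y) = \<chi> x * \<chi> y"
  by (auto simp: mult_char_def)

lemma mult_char_1: "mult_char \<chi> \<Longrightarrow> \<chi> 1 = 1"
  by (metis mult.right_neutral mult_cancel_left mult_char_mult mult_char_nonzero one_neq_zero)

lemma mult_char_power: "mult_char \<chi> \<Longrightarrow> \<chi> (x ^ n) = \<chi> x ^ n"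
  by (induction n) (simp_all add: mult_char_1 mult_char_mult)

lemma mult_char_inverse:
  assumes "mult_char \<chi>"
  shows "\<chi> (inverse x) = inverse (\<chi> x)"
proof (cases "x = 0")
  case False
  have "\<chi> x * \<chi> (inverse x) = 1"
    using False mult_char_mult[OF assms, of x "inverse x"] mult_char_1[OF assms] by simp
  then show ?thesis
    by (metis inverse_unique)
qed (simp add: mult_char_0[OF assms])

text \<open>Multiplication by \<open>x\<close> permutes the nonzero elements, so comparing the
  products of all nonzero character values makes \<open>\<chi> x\<close> a root of unity.\<close>

lemma mult_char_norm:
  fixes \<chi> :: "'a::{field,finite} \<Rightarrow> complex"
  assumes "mult_char \<chi>" and "x \<noteq> 0"
  shows "norm (\<chi> x) = 1"
proof -
  let ?U = "UNIV - {0 :: 'a}"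
  have "(\<Prod>y\<in>?U. \<chi> y) = (\<Prod>y\<in>?U. \<chi> (x * y))"
    by (rule prod.reindex_bij_witness[of _ "\<lambda>y. x * y" "\<lambda>y. y / x"]) (use assms(2) in auto)
  also have "\<dots> = \<chi> x ^ card ?U * (\<Prod>y\<in>?U. \<chi> y)"
    by (simp add: mult_char_mult[OF assms(1)] prod.distrib)
  finally have "\<chi> x ^ card ?U = 1"
    using mult_char_nonzero[OF assms(1)] by simp
  moreover have "card ?U \<noteq> 0"
  proof -
    have "1 \<in> ?U" by simp
    then show ?thesis by (metis card_eq_0_iff empty_iff finite)
  qed
  ultimately show ?thesis
    by (metis power_eq_1_iff)
qed

text \<open>On the unit circle conjugation is inversion. Moving it into the argument later allows
  all values of \<open>D\<close> to be merged into a single one.\<close>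

lemma mult_char_cnj:
  fixes \<chi> :: "'a::{field,finite} \<Rightarrow> complex"
  assumes "mult_char \<chi>"
  shows "cnj (\<chi> x) = \<chi> (inverse x)"
proof (cases "x = 0")
  case False
  then have "\<chi> x * cnj (\<chi> x) = 1"
    using mult_char_norm[OF assms] by (simp flip: complex_norm_square)
  then show ?thesis
    by (metis inverse_unique mult_char_inverse[OF assms])
qed (simp add: mult_char_0[OF assms])

section \<open>The quadratic character and its relation to quartic characters\<close>

lemma quadratic_char_0 [simp]: "quadratic_char 0 = 0"
  by (simp add: quadratic_char_def)

lemma quadratic_char_power2 [simp]: "x \<noteq> 0 \<Longrightarrow> quadratic_char (x\<^sup>2) = 1"
  by (auto simp: quadratic_char_def)

lemma two_neq_zero_if_odd_CARD:
  assumes "odd CARD('a::{field,finite})"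
  shows "(2 :: 'a) \<noteq> 0"
proof
  assume "(2 :: 'a) = 0"
  then have "CHAR('a) dvd 2"
    by (metis of_nat_eq_0_iff_char_dvd of_nat_numeral)
  moreover have "CHAR('a) \<noteq> 1"
    by simp
  ultimately have "CHAR('a) = 2"
    by (metis prime_nat_iff two_is_prime_nat)
  then show False
    using assms CHAR_dvd_CARD[where 'a = 'a] by simp
qed

text \<open>Every nonempty fibre of squaring on the nonzero elements is a pair
  \<open>{b, - b}\<close> of distinct elements.\<close>

lemma card_nonzero_squares:
  assumes "(2 :: 'a::{field,finite}) \<noteq> 0"
  shows "2 * card ((\<lambda>x::'a. x\<^sup>2) ` (UNIV - {0})) = card (UNIV - {0 :: 'a})"
proof -
  let ?U = "UNIV - {0 :: 'a}"
  let ?S = "(\<lambda>x::'a. x\<^sup>2) ` ?U"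
  have "card ?U = (\<Sum>s\<in>?S. card {x \<in> ?U. x\<^sup>2 = s})"
    unfolding card_eq_sum by (rule sum.group[symmetric]) auto
  also have "\<dots> = (\<Sum>s\<in>?S. 2)"
  proof (rule sum.cong[OF refl])
    fix s assume "s \<in> ?S"
    then obtain b where b: "b \<noteq> 0" "s = b\<^sup>2" by blast
    have "{x \<in> ?U. x\<^sup>2 = s} = {b, - b}"
      using b by (auto simp: power2_eq_iff)
    moreover have "b \<noteq> - b"
      using b assms by (metis add.right_inverse mult_2 mult_eq_0_iff)
    ultimately show "card {x \<in> ?U. x\<^sup>2 = s} = 2" by simp
  qed
  finally show ?thesis by simp
qed

text \<open>The nonzero squares \<open>?S\<close> and their coset \<open>?T\<close> by
  \<open>c\<close> are disjoint, and each contains half of the nonzero elements. Hence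
  \<open>d\<close> lies in the coset, and \<open>c * d\<close> is a square.\<close>

lemma nonsquare_mult_nonsquare:
  fixes c d :: "'a::{field,finite}"
  assumes "(2 :: 'a) \<noteq> 0" and c: "\<nexists>y. c = y\<^sup>2" and d: "\<nexists>y. d = y\<^sup>2"
  shows "\<exists>y. c * d = y\<^sup>2"
proof -
  let ?U = "UNIV - {0 :: 'a}"
  let ?S = "(\<lambda>x::'a. x\<^sup>2) ` ?U"
  let ?T = "(\<lambda>x. c * x) ` ?S"
  have [simp]: "c \<noteq> 0" "d \<noteq> 0"
    using c d by (metis zero_power2)+
  have "?S \<inter> ?T = {}"
  proof (rule ccontr)
    assume "?S \<inter> ?T \<noteq> {}"
    then obtain x y where "x \<noteq> 0" "y\<^sup>2 = c * x\<^sup>2" by auto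
    then have "c = (y / x)\<^sup>2" by (simp add: power_divide)
    with c show False by blast
  qed
  moreover have "card ?T = card ?S"
    by (rule card_image) (simp add: inj_on_def)
  ultimately have "card (?S \<union> ?T) = card ?U"
    using card_nonzero_squares[OF assms(1)] by (simp add: card_Un_disjoint)
  then have "?S \<union> ?T = ?U"
    by (intro card_subset_eq) auto
  then have "d \<in> ?S \<union> ?T" by simp
  then obtain x where "d = c * x\<^sup>2" using d by auto
  then have "c * d = (c * x)\<^sup>2" by (simp add: power2_eq_square)
  then show ?thesis ..
qed

lemma mult_char_quadratic_char:
  assumes "(2 :: 'a::{field,finite}) \<noteq> 0"
  shows "mult_char (quadratic_char :: 'a \<Rightarrow> complex)"
proof -
  have "quadratic_char (x * y) = (quadratic_char x * quadratic_char y :: complex)" for x y :: 'a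
  proof -
    have sq: "quadratic_char (a\<^sup>2 * b) = quadratic_char b" if "a \<noteq> 0" for a b :: 'a
    proof -
      have "(\<exists>y. a\<^sup>2 * b = y\<^sup>2) \<longleftrightarrow> (\<exists>y. b = y\<^sup>2)"
      proof
        assume "\<exists>y. a\<^sup>2 * b = y\<^sup>2"
        then obtain y where "a\<^sup>2 * b = y\<^sup>2" ..
        then have "b = (y / a)\<^sup>2" using that by (simp add: field_simps power_divide)
        then show "\<exists>y. b = y\<^sup>2" ..
      qed (metis power_mult_distrib)
      then show ?thesis using that by (simp add: quadratic_char_def)
    qed
    consider "x = 0 \<or> y = 0" | a where "a \<noteq> 0" "x = a\<^sup>2" | a where "a \<noteq> 0" "y = a\<^sup>2"
      | "x \<noteq> 0" "y \<noteq> 0" "\<nexists>a. x = a\<^sup>2" "\<nexists>a. y = a\<^sup>2"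
      by (metis zero_power2)
    then show ?thesis
    proof cases
      case 4
      with nonsquare_mult_nonsquare[OF assms 4(3,4)] show ?thesis
        by (simp add: quadratic_char_def)
    qed (auto simp: sq mult.commute[of x])
  qed
  then show ?thesis
    by (simp add: mult_char_def quadratic_char_def)
qed

lemma quadratic_char_inverse:
  assumes "(2 :: 'a::{field,finite}) \<noteq> 0"
  shows "quadratic_char (inverse x) = quadratic_char (x :: 'a)"
  unfolding mult_char_inverse[OF mult_char_quadratic_char[OF assms]]
  by (simp add: quadratic_char_def)

text \<open>The square of \<open>\<chi>\<close> has values 1 and -1 off zero and is 1 on nonzero
  squares. Order exactly 4 yields some \<open>c\<close> where it is -1; for a nonsquare
  \<open>x\<close>, the product \<open>x * c\<close> is a square, which forces the value -1 at
  \<open>x\<close>.\<close>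

lemma power2_quartic_char:
  fixes \<chi> :: "'a::{field,finite} \<Rightarrow> complex"
  assumes two: "(2 :: 'a) \<noteq> 0" and \<chi>: "mult_char \<chi>" and ord: "char_has_order \<chi> 4"
  shows "\<chi> x ^ 2 = quadratic_char x"
proof -
  have four: "\<chi> y ^ 4 = 1" if "y \<noteq> 0" for y
    using ord that by (auto simp: char_has_order_def trivial_char_def fun_eq_iff)
  have sq: "\<chi> (y\<^sup>2) ^ 2 = 1" if "y \<noteq> 0" for y
    using four[OF that] by (simp add: mult_char_power[OF \<chi>] flip: power_mult)
  have pm: "\<chi> y ^ 2 = 1 \<or> \<chi> y ^ 2 = - 1" if "y \<noteq> 0" for y
    using four[OF that] by (simp flip: power_mult power2_eq_1_iff)
  have "(\<lambda>x. \<chi> x ^ 2) \<noteq> trivial_char"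
    using ord by (simp add: char_has_order_def)
  then obtain c where c: "c \<noteq> 0" "\<chi> c ^ 2 \<noteq> 1"
    using mult_char_0[OF \<chi>] by (auto simp: trivial_char_def fun_eq_iff split: if_splits)
  have c_nsq: "\<nexists>y. c = y\<^sup>2"
    using c sq by (metis zero_power2)
  consider "x = 0" | y where "y \<noteq> 0" "x = y\<^sup>2" | "x \<noteq> 0" "\<nexists>y. x = y\<^sup>2"
    by (metis zero_power2)
  then show ?thesis
  proof cases
    case 3
    then obtain y where y: "x * c = y\<^sup>2"
      using nonsquare_mult_nonsquare[OF two _ c_nsq] by blast
    then have "\<chi> (x * c) ^ 2 = 1"
      using 3 c sq[of y] by (metis mult_eq_0_iff zero_power2)
    then have "\<chi> x ^ 2 * \<chi> c ^ 2 = 1"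
      by (simp add: mult_char_mult[OF \<chi>] power_mult_distrib)
    then show ?thesis
      using 3 pm[OF c(1)] c(2) pm[OF 3(1)] by (auto simp: quadratic_char_def)
  qed (auto simp: sq mult_char_0[OF \<chi>])
qed

text \<open>A character squaring to \<phi> gives \<phi>(-1) = \<open>\<chi>\<close>((-1)^2) =
  1.\<close>

lemma quadratic_char_uminus:
  fixes \<chi> :: "'a::{field,finite} \<Rightarrow> complex"
  assumes two: "(2 :: 'a) \<noteq> 0" and \<chi>: "mult_char \<chi>" and \<chi>2: "\<And>x. \<chi> x ^ 2 = quadratic_char x"
  shows "quadratic_char (- x) = quadratic_char (x :: 'a)"
proof -
  have "quadratic_char (- 1 :: 'a) = 1"
    using mult_char_power[OF \<chi>, of "- 1" 2] \<chi>2[of "- 1"] mult_char_1[OF \<chi>] by simp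
  then show ?thesis
    using mult_char_mult[OF mult_char_quadratic_char[OF two], of "- 1" x] by simp
qed

section \<open>Character sums along the map a + 1/a\<close>

text \<open>If r = a + 1/a, then r + 2 = (a + 1)^2 / a and r - 2 = (a - 1)^2 / a, so both terms on
  the right equal \<phi>(a) unless a = 1 or a = -1. There one term vanishes, just as the fibre {a,
  1/a} shrinks to one point. If r has no such form, the discriminant (r + 2)(r - 2) is a nonsquare
  and the two terms cancel.\<close>

lemma sum_quadratic_char_joukowski_fibre:
  fixes r :: "'a::{field,finite}"
  assumes two: "(2 :: 'a) \<noteq> 0"
  shows "(\<Sum>a | a + inverse a = r. quadratic_char a) = quadratic_char (r + 2) + quadratic_char (r - 2)"
proof -
  note \<phi> = mult_char_quadratic_char[OF two]
  have four: "(4 :: 'a) \<noteq> 0"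
    using two by (metis mult_2_right mult_eq_0_iff numeral_Bit0)
  show ?thesis
  proof (cases "\<exists>a. a \<noteq> 0 \<and> a + inverse a = r")
    case True
    then obtain a where a: "a \<noteq> 0" "r = a + inverse a" by blast
    have fibre: "b = a \<or> b = inverse a" if "b \<noteq> 0" "b + inverse b = r" for b
    proof -
      have "(b - a) * (a * b - 1) = 0"
        using that a by (simp add: field_simps)
      then show ?thesis
        by (metis eq_iff_diff_eq_0 inverse_unique mult_eq_0_iff)
    qed
    \<comment> \<open>Since \<open>inverse 0 = 0\<close>, the index set also contains 0 when
      \<open>r = 0\<close>; that term is zero.\<close>
    have sum: "(\<Sum>b | b + inverse b = r. quadratic_char b) = (\<Sum>b\<in>{a, inverse a}. quadratic_char b)"
    proof (rule sum.mono_neutral_right)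
      show "\<forall>b\<in>{b. b + inverse b = r} - {a, inverse a}. quadratic_char b = 0"
        by (metis (mono_tags, lifting) DiffE fibre insertCI mem_Collect_eq quadratic_char_0)
    qed (use a in \<open>auto simp: add.commute\<close>)
    have inv: "quadratic_char (inverse a) = quadratic_char a"
      by (rule quadratic_char_inverse[OF two])
    have plus: "quadratic_char (r + 2) = quadratic_char a" if "a \<noteq> - 1"
    proof -
      have "r + 2 = (a + 1)\<^sup>2 * inverse a"
        using a by (simp add: field_simps power2_eq_square)
      moreover have "a + 1 \<noteq> 0"
        using that by (simp add: eq_neg_iff_add_eq_0)
      ultimately show ?thesis
        by (simp add: mult_char_mult[OF \<phi>] inv)
    qed
    have minus: "quadratic_char (r - 2) = quadratic_char a" if "a \<noteq> 1"
    proof -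
      have "r - 2 = (a - 1)\<^sup>2 * inverse a"
        using a by (simp add: field_simps power2_eq_square)
      then show ?thesis
        using that by (simp add: mult_char_mult[OF \<phi>] inv)
    qed
    have self_inverse: "a = inverse a \<longleftrightarrow> a = 1 \<or> a = - 1"
      using a by (auto simp: field_simps simp flip: power2_eq_square power2_eq_1_iff)
    have "(1 :: 'a) \<noteq> - 1"
      using two by (metis add.right_inverse one_add_one)
    then consider "a = 1" "a \<noteq> - 1" | "a = - 1" "a \<noteq> 1" | "a \<noteq> 1" "a \<noteq> - 1"
      by metis
    then show ?thesis
    proof cases
      case 1
      then show ?thesis
        using a(2) plus unfolding sum by simp
    next
      case 2
      then show ?thesis
        using a(2) minus unfolding sum by simp
    next
      case 3
      then show ?thesis
        using self_inverse inv plus minus unfolding sum by simp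
    qed
  next
    case False
    have nsq: "\<nexists>d. (r + 2) * (r - 2) = d\<^sup>2"
    proof
      assume "\<exists>d. (r + 2) * (r - 2) = d\<^sup>2"
      then obtain d where d: "(r + 2) * (r - 2) = d\<^sup>2" ..
      \<comment> \<open>The roots of t^2 - r t + 1, whose discriminant is d^2; their product 1 makes
        them mutually inverse.\<close>
      define a where "a = (r + d) / 2"
      define b where "b = (r - d) / 2"
      have "a * b = (r\<^sup>2 - d\<^sup>2) / 4"
        by (simp add: a_def b_def field_simps power2_eq_square)
      also have "r\<^sup>2 - d\<^sup>2 = 4"
        unfolding d[symmetric] by (simp add: algebra_simps power2_eq_square)
      finally have "a * b = 1"
        using four by simp
      moreover have "a + b = r"
        using two by (simp add: a_def b_def flip: add_divide_distrib)
      ultimately show False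
        using False by (metis inverse_unique mult_zero_left zero_neq_one)
    qed
    then have "quadratic_char ((r + 2) * (r - 2)) = - 1"
      by (metis quadratic_char_def zero_power2)
    then have "quadratic_char (r + 2) + quadratic_char (r - 2) = 0"
      by (auto simp: mult_char_mult[OF \<phi>]) (auto simp: quadratic_char_def split: if_splits)
    moreover have "(\<Sum>a | a + inverse a = r. quadratic_char a) = 0"
      by (rule sum.neutral) (use False in \<open>auto simp: quadratic_char_def\<close>)
    ultimately show ?thesis
      by simp
  qed
qed

lemma sum_quartic_char_joukowski:
  fixes \<chi> :: "'a::{field,finite} \<Rightarrow> complex" and g :: "'a \<Rightarrow> complex"
  assumes two: "(2 :: 'a) \<noteq> 0" and \<chi>: "mult_char \<chi>" and \<chi>2: "\<And>x. \<chi> x ^ 2 = quadratic_char x"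
  shows "(\<Sum>u\<in>UNIV. \<chi> u * g (u + inverse u)) = (\<Sum>r\<in>UNIV. quadratic_char (2 + r) * g (r\<^sup>2 - 2))"
proof -
  note \<phi> = mult_char_quadratic_char[OF two]
  note neg = quadratic_char_uminus[OF two \<chi> \<chi>2]
  have neg': "quadratic_char (- r - 2) = quadratic_char (2 + r)" for r :: 'a
    using neg[of "2 + r"] by (simp add: minus_diff_commute)
  have bij_inverse: "bij (inverse :: 'a \<Rightarrow> 'a)"
    by (rule o_bij[of inverse]) auto
  \<comment> \<open>For u = b^2 both terms on the left equal \<phi>(b), as do the contributions of b
    and -b on the right. For a nonsquare, \<open>\<chi> u\<close> squares to -1, so its inverse is
    its negative.\<close>
  have pair: "\<chi> u + \<chi> (inverse u) = (\<Sum>a | a\<^sup>2 = u. quadratic_char a)" for u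
  proof -
    consider "u = 0" | b where "b \<noteq> 0" "u = b\<^sup>2" | "u \<noteq> 0" "\<nexists>b. u = b\<^sup>2"
      by (metis zero_power2)
    then show ?thesis
    proof cases
      case 2
      have "b \<noteq> - b"
        using 2 two by (metis add.right_inverse mult_2 mult_eq_0_iff)
      moreover have "{a. a\<^sup>2 = u} = {b, - b}"
        using 2 by (auto simp: power2_eq_iff)
      moreover have "\<chi> u = quadratic_char b"
        using 2 \<chi>2 mult_char_power[OF \<chi>] by simp
      moreover have "\<chi> (inverse u) = quadratic_char b"
        using 2 \<open>\<chi> u = _\<close> by (simp add: mult_char_inverse[OF \<chi>] quadratic_char_def)
      ultimately show ?thesis
        by (simp add: neg)
    next
      case 3
      then have "\<chi> u * \<chi> u = - 1"
        using \<chi>2[of u] by (simp add: quadratic_char_def power2_eq_square)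
      then have "inverse (\<chi> u) = - \<chi> u"
        by (intro inverse_unique) simp
      moreover have "{a. a\<^sup>2 = u} = {}"
        using 3 by auto
      ultimately show ?thesis
        by (simp add: mult_char_inverse[OF \<chi>])
    qed (simp add: mult_char_0[OF \<chi>])
  qed
  let ?L = "\<Sum>u\<in>UNIV. \<chi> u * g (u + inverse u)"
  let ?R = "\<Sum>r\<in>UNIV. quadratic_char (2 + r) * g (r\<^sup>2 - 2)"
  have "?L = (\<Sum>u\<in>UNIV. \<chi> (inverse u) * g (u + inverse u))"
    using sum.reindex_bij_betw[OF bij_inverse, of "\<lambda>u. \<chi> u * g (u + inverse u)"]
    by (simp add: add.commute)
  then have "2 * ?L = (\<Sum>u\<in>UNIV. (\<chi> u + \<chi> (inverse u)) * g (u + inverse u))"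
    by (simp add: distrib_right sum.distrib)
  also have "\<dots> = (\<Sum>u\<in>UNIV. \<Sum>a | a\<^sup>2 = u. quadratic_char a * g (a\<^sup>2 + inverse (a\<^sup>2)))"
    by (simp add: pair sum_distrib_right)
  also have "\<dots> = (\<Sum>a\<in>UNIV. quadratic_char a * g (a\<^sup>2 + inverse (a\<^sup>2)))"
    using sum.group[of UNIV UNIV "\<lambda>a. a\<^sup>2" "\<lambda>a. quadratic_char a * g (a\<^sup>2 + inverse (a\<^sup>2))"]
    by simp
  \<comment> \<open>At \<open>a = 0\<close> the arguments of \<open>g\<close> are 0 and -2, but the
    factor \<phi>(0) = 0 removes the term.\<close>
  also have "\<dots> = (\<Sum>a\<in>UNIV. quadratic_char a * g ((a + inverse a)\<^sup>2 - 2))"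
  proof (rule sum.cong[OF refl])
    fix a :: 'a
    show "quadratic_char a * g (a\<^sup>2 + inverse (a\<^sup>2)) = quadratic_char a * g ((a + inverse a)\<^sup>2 - 2)"
      by (cases "a = 0") (simp_all add: power2_sum power_inverse mult.assoc)
  qed
  also have "\<dots> = (\<Sum>r\<in>UNIV. \<Sum>a | a + inverse a = r. quadratic_char a * g ((a + inverse a)\<^sup>2 - 2))"
    using sum.group[of UNIV UNIV "\<lambda>a. a + inverse a"
        "\<lambda>a. quadratic_char a * g ((a + inverse a)\<^sup>2 - 2)"] by simp
  also have "\<dots> = (\<Sum>r\<in>UNIV. (quadratic_char (r + 2) + quadratic_char (r - 2)) * g (r\<^sup>2 - 2))"
    by (simp add: sum_quadratic_char_joukowski_fibre[OF two, symmetric] sum_distrib_right)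
  also have "\<dots> = ?R + (\<Sum>r\<in>UNIV. quadratic_char (r - 2) * g (r\<^sup>2 - 2))"
    by (simp add: distrib_right sum.distrib add.commute)
  \<comment> \<open>The substitution of -r for r fixes r^2 - 2, and \<phi> is even.\<close>
  also have "(\<Sum>r\<in>UNIV. quadratic_char (r - 2) * g (r\<^sup>2 - 2)) = ?R"
    using sum.reindex_bij_betw[OF bij_uminus, of "\<lambda>r. quadratic_char (r - 2) * g (r\<^sup>2 - 2)"]
    by (simp add: neg')
  finally show ?thesis by simp
qed

section \<open>The hypergeometric transformation\<close>

theorem theorem3:
  fixes \<chi>\<^sub>4 D :: "'a::{field,finite} \<Rightarrow> complex" and z :: 'a and p n :: nat
  assumes "prime p" and "odd p" and "CARD('a) = p ^ n"
    and "[CARD('a) = 1] (mod 4)"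
    and "mult_char \<chi>\<^sub>4" and "char_has_order \<chi>\<^sub>4 4"
    and "z \<notin> {0, 1, - 1}"
    and "mult_char D"
  shows "D (z - 1) ^ 4 * hyp2F1 D (\<lambda>x. D x * \<chi>\<^sub>4 x) \<chi>\<^sub>4 (z ^ 4) =
         hyp2F1 D (\<lambda>x. D x ^ 2 * quadratic_char x) (\<lambda>x. D x * quadratic_char x)
           (- (((z + 1) / (z - 1)) ^ 2))"
proof -
  have "odd CARD('a)"
    using assms(2,3) by simp
  then have two: "(2 :: 'a) \<noteq> 0"
    by (rule two_neq_zero_if_odd_CARD)
  note \<chi> = assms(5) and D = assms(8)
  note \<phi> = mult_char_quadratic_char[OF two]
  have \<chi>2: "\<chi>\<^sub>4 x ^ 2 = quadratic_char x" for x
    by (rule power2_quartic_char[OF two \<chi> assms(6)])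
  have z: "z \<noteq> 0" "z - 1 \<noteq> 0" "z + 1 \<noteq> 0"
    using assms(7) by (auto simp: add_eq_0_iff2)
  note neg = quadratic_char_uminus[OF two \<chi> \<chi>2]
  \<comment> \<open>\<open>E\<close> is the conjugate of \<open>D\<close>. Every factor involving
    \<open>D\<close> becomes a value of \<open>E\<close>, so that multiplicativity collects them
    under one argument.\<close>
  define E where "E x = D (inverse x)" for x
  have E_mult: "E (x * y) = E x * E y" for x y
    by (simp add: E_def mult_char_mult[OF D])
  have E_power: "E (x ^ k) = E x ^ k" for x k
    by (simp add: E_def mult_char_power[OF D] flip: power_inverse)
  have E_0: "E 0 = 0"
    by (simp add: E_def mult_char_0[OF D])
  have D_E: "D x = E (inverse x)" for x
    by (simp add: E_def)
  have cnj_D: "cnj (D x) = E x" for x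
    by (simp add: E_def mult_char_cnj[OF D])
  have cancel: "cnj (\<psi> x) * \<psi> x = 1" if "mult_char \<psi>" "x \<noteq> 0" for \<psi> and x :: 'a
    using that by (simp add: mult_char_cnj mult_char_inverse mult_char_nonzero)
  have cnj_D\<chi>: "cnj (D x * \<chi>\<^sub>4 x) * \<chi>\<^sub>4 x = E x" for x
    using cancel[OF \<chi>, of x] by (cases "x = 0") (simp_all add: cnj_D E_0 mult_char_0[OF \<chi>] mult.assoc)
  define x where "x = - (((z + 1) / (z - 1)) ^ 2)"
  define g where "g s = E ((1 + z ^ 4 - s * z\<^sup>2) / (z - 1) ^ 4)" for s
  have "D (z - 1) ^ 4 * (\<Sum>y\<in>UNIV. D y * \<chi>\<^sub>4 y * (cnj (D (y - 1) * \<chi>\<^sub>4 (y - 1)) * \<chi>\<^sub>4 (y - 1))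
          * cnj (D (1 - z ^ 4 * y)))
      = (\<Sum>y\<in>UNIV. \<chi>\<^sub>4 y * E (inverse y * (y - 1) * (1 - z ^ 4 * y) / (z - 1) ^ 4))"
    unfolding sum_distrib_left
  proof (rule sum.cong[OF refl])
    fix y :: 'a
    show "D (z - 1) ^ 4 * (D y * \<chi>\<^sub>4 y * (cnj (D (y - 1) * \<chi>\<^sub>4 (y - 1)) * \<chi>\<^sub>4 (y - 1))
          * cnj (D (1 - z ^ 4 * y)))
      = \<chi>\<^sub>4 y * E (inverse y * (y - 1) * (1 - z ^ 4 * y) / (z - 1) ^ 4)"
      unfolding cnj_D cnj_D\<chi>
      by (simp add: D_E divide_inverse E_mult E_power mult_ac flip: power_inverse)
  qed
  \<comment> \<open>This scaling turns the numerator inside \<open>E\<close> into (1 - z^2/u)(1 -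
    z^2 u) for nonzero u, which is symmetric under inversion of u. The character contributes
    \<phi>(z).\<close>
  also have "\<dots> = (\<Sum>u\<in>UNIV. \<chi>\<^sub>4 (u / z\<^sup>2) * E (inverse (u / z\<^sup>2) * (u / z\<^sup>2 - 1) * (1 - z ^ 4 * (u / z\<^sup>2)) / (z - 1) ^ 4))"
    by (rule sum.reindex_bij_witness[of _ "\<lambda>u. u / z\<^sup>2" "\<lambda>y. y * z\<^sup>2"]) (use z in auto)
  also have "\<dots> = (\<Sum>u\<in>UNIV. quadratic_char z * (\<chi>\<^sub>4 u * g (u + inverse u)))"
  proof (rule sum.cong[OF refl])
    fix u :: 'a
    show "\<chi>\<^sub>4 (u / z\<^sup>2) * E (inverse (u / z\<^sup>2) * (u / z\<^sup>2 - 1) * (1 - z ^ 4 * (u / z\<^sup>2)) / (z - 1) ^ 4)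
        = quadratic_char z * (\<chi>\<^sub>4 u * g (u + inverse u))"
    proof (cases "u = 0")
      case False
      have "inverse (u / z\<^sup>2) * (u / z\<^sup>2 - 1) * (1 - z ^ 4 * (u / z\<^sup>2)) = 1 + z ^ 4 - (u + inverse u) * z\<^sup>2"
        using False z(1) by (simp add: field_simps power2_eq_square power4_eq_xxxx)
      moreover have "\<chi>\<^sub>4 (u / z\<^sup>2) = quadratic_char z * \<chi>\<^sub>4 u"
        using quadratic_char_inverse[OF two, of z] by (simp add: divide_inverse mult_char_mult[OF \<chi>] mult_char_power[OF \<chi>] \<chi>2 flip: power_inverse)
      ultimately show ?thesis by (simp add: g_def)
    qed (simp add: mult_char_0[OF \<chi>])
  qed
  also have "\<dots> = (\<Sum>r\<in>UNIV. quadratic_char z * (quadratic_char (2 + r) * g (r\<^sup>2 - 2)))"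
    by (simp add: sum_quartic_char_joukowski[OF two \<chi> \<chi>2] flip: sum_distrib_left)
  also have "\<dots> = (\<Sum>w\<in>UNIV. quadratic_char w * E ((1 - w) * (w - x)))"
  proof (rule sum.reindex_bij_witness[of _ "\<lambda>w. - w * (z - 1)\<^sup>2 / z - 2" "\<lambda>r. - z * (2 + r) / (z - 1)\<^sup>2"])
    fix r :: 'a
    define w where "w = - z * (2 + r) / (z - 1)\<^sup>2"
    have "(z - 1)\<^sup>2 * w = - (z * (2 + r))" "(z - 1)\<^sup>2 * x = - (z + 1)\<^sup>2"
      using z by (simp_all add: w_def x_def power_divide)
    \<comment> \<open>The right-hand sides are z^2 + 1 + z r and z^2 + 1 - z r, so their product
      depends on r only through r^2.\<close>
    then have "(z - 1)\<^sup>2 * (1 - w) = (z - 1)\<^sup>2 + z * (2 + r)"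
      and "(z - 1)\<^sup>2 * (w - x) = (z + 1)\<^sup>2 - z * (2 + r)"
      by (simp_all add: right_diff_distrib[of "(z - 1)\<^sup>2"])
    then have "((z - 1)\<^sup>2 * (1 - w)) * ((z - 1)\<^sup>2 * (w - x)) = 1 + z ^ 4 - (r\<^sup>2 - 2) * z\<^sup>2"
      by (simp add: algebra_simps power2_eq_square power4_eq_xxxx)
    then have "(1 - w) * (w - x) = (1 + z ^ 4 - (r\<^sup>2 - 2) * z\<^sup>2) / (z - 1) ^ 4"
      using z by (simp add: eq_divide_eq power2_eq_square power4_eq_xxxx mult_ac)
    moreover have "quadratic_char w = quadratic_char z * quadratic_char (2 + r)"
    proof -
      have "w = - (z * (2 + r) * (inverse (z - 1))\<^sup>2)"
        by (simp add: w_def divide_inverse power_inverse)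
      then show ?thesis
        using z by (simp only: neg mult_char_mult[OF \<phi>]) simp
    qed
    ultimately show "quadratic_char (- z * (2 + r) / (z - 1)\<^sup>2) *
         E ((1 - - z * (2 + r) / (z - 1)\<^sup>2) * (- z * (2 + r) / (z - 1)\<^sup>2 - x)) =
         quadratic_char z * (quadratic_char (2 + r) * g (r\<^sup>2 - 2))"
      unfolding w_def[symmetric] g_def by simp
  qed (use z in auto)
  also have "\<dots> = (\<Sum>y\<in>UNIV. quadratic_char (inverse y) * E ((1 - inverse y) * (inverse y - x)))"
    by (rule sum.reindex_bij_witness[of _ inverse inverse]) auto
  also have "\<dots> = (\<Sum>y\<in>UNIV. D y ^ 2 * quadratic_char y * (cnj (D (y - 1) ^ 2 * quadratic_char (y - 1))
      * (D (y - 1) * quadratic_char (y - 1))) * cnj (D (1 - x * y)))"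
  proof (rule sum.cong[OF refl])
    fix y :: 'a
    show "quadratic_char (inverse y) * E ((1 - inverse y) * (inverse y - x)) =
      D y ^ 2 * quadratic_char y * (cnj (D (y - 1) ^ 2 * quadratic_char (y - 1))
      * (D (y - 1) * quadratic_char (y - 1))) * cnj (D (1 - x * y))"
    \<comment> \<open>Both sides vanish at these two points, where the cancellations below would
      divide by zero.\<close>
    proof (cases "y = 0 \<or> y = 1")
      case False
      then have arg: "(1 - inverse y) * (inverse y - x) = (inverse y)\<^sup>2 * ((y - 1) * (1 - x * y))"
        by (simp add: field_simps power2_eq_square)
      \<comment> \<open>The \<phi> factors and one pair of \<open>D\<close> factors cancel, leaving
        the conjugate of \<open>D\<close>.\<close>
      have lower: "cnj (D (y - 1) ^ 2 * quadratic_char (y - 1)) * (D (y - 1) * quadratic_char (y - 1))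
          = E (y - 1)"
        using False cancel[OF D, of "y - 1"] cancel[OF \<phi>, of "y - 1"]
        by (simp add: cnj_D power2_eq_square mult_ac)
      show ?thesis
        unfolding arg lower cnj_D
        by (simp add: quadratic_char_inverse[OF two] E_mult E_power D_E mult_ac)
    qed (auto simp: E_0)
  qed
  \<comment> \<open>Both arguments, \<open>z ^ 4\<close> and \<open>x\<close>, are nonzero, so both
    sides carry the same prefactor 1/q.\<close>
  finally show ?thesis
    using z by (simp add: hyp2F1_def trivial_char_def x_def mult_ac)
qed

end
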